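(* Let $f:\mathbb{R}^n_{>0}\to\mathbb{R}^n_{>0}$ be order-preserving, homogeneous, and real analytic. The eigenspace $E(f)$ is nonempty and bounded in $(\mathbb{R}^n_{>0},d_H)$ if and only if $f$ has a unique eigenvector in $\mathbb{R}^n_{>0}$ up to scaling.
   Context: Entrywise order on $\mathbb{R}^n$. Order-preserving: $x\le y\Rightarrow f(x)\le f(y)$; homogeneous: $f(tx)=tf(x)$ for $t>0$; real analytic: each entry of $f$ is real analytic on $\mathbb{R}^n_{>0}$. $d_H(x,y)=\log\max_{i,j}\frac{y_ix_j}{x_iy_j}$ is Hilbert's projective metric; $E(f)=\{x\in\mathbb{R}^n_{>0}:f(x)=\mu x\text{ for some }\mu\}$. *)

theory Defs
  imports "HOL-Analysis.Analysis"
begin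

definition pos_cone :: "(real ^ 'n) set" where
  "pos_cone = {x. \<forall>i. 0 < x $ i}"

definition vle :: "real ^ 'n \<Rightarrow> real ^ 'n \<Rightarrow> bool" where
  "vle x y \<longleftrightarrow> (\<forall>i. x $ i \<le> y $ i)"

definition order_preserving_on :: "(real ^ 'n) set \<Rightarrow> (real ^ 'n \<Rightarrow> real ^ 'n) \<Rightarrow> bool" where
  "order_preserving_on S f \<longleftrightarrow> (\<forall>x\<in>S. \<forall>y\<in>S. vle x y \<longrightarrow> vle (f x) (f y))"

definition homogeneous_on :: "(real ^ 'n) set \<Rightarrow> (real ^ 'n \<Rightarrow> real ^ 'n) \<Rightarrow> bool" where
  "homogeneous_on S f \<longleftrightarrow> (\<forall>x\<in>S. \<forall>t::real. t > 0 \<longrightarrow> f (t *\<^sub>R x) = t *\<^sub>R f x)"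

definition real_analytic_on :: "(real ^ 'n \<Rightarrow> real) \<Rightarrow> (real ^ 'n) set \<Rightarrow> bool" where
  "real_analytic_on g S \<longleftrightarrow>
     (\<forall>x\<in>S. \<exists>r>0. ball x r \<subseteq> S \<and>
        (\<exists>c :: ('n \<Rightarrow> nat) \<Rightarrow> real. \<forall>y\<in>ball x r.
            ((\<lambda>\<alpha>. c \<alpha> * (\<Prod>i\<in>UNIV. (y $ i - x $ i) ^ \<alpha> i)) has_sum g y) UNIV))"

definition hilbert_metric :: "real ^ 'n \<Rightarrow> real ^ 'n \<Rightarrow> real" where
  "hilbert_metric x y = ln (Max {(y $ i * x $ j) / (x $ i * y $ j) | i j. True})"

definition eigenspace_pos :: "(real ^ 'n \<Rightarrow> real ^ 'n) \<Rightarrow> (real ^ 'n) set" where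
  "eigenspace_pos f = {x \<in> pos_cone. \<exists>\<mu>::real. f x = \<mu> *\<^sub>R x}"

definition hilbert_bounded :: "(real ^ 'n) set \<Rightarrow> bool" where
  "hilbert_bounded A \<longleftrightarrow> (\<exists>B. \<forall>x\<in>A. \<forall>y\<in>A. hilbert_metric x y \<le> B)"

end

theory Submission
  imports Defs "HOL-Complex_Analysis.Cauchy_Integral_Formula"
begin

text \<open>
  All eigenvectors have the same eigenvalue. If \<open>u\<close> and \<open>v\<close> are eigenvectors that are not
  proportional, let \<open>M\<close> be the largest ratio \<open>v\<^sub>i / u\<^sub>i\<close>, attained on \<open>I\<close>. The entries of \<open>f\<close> in \<open>I\<close>
  agree at \<open>v\<close> and \<open>M u\<close>, so by monotonicity they are constant on the order interval between
  them, and by analyticity they are determined by the coordinates in \<open>I\<close> as soon as these are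
  proportional to \<open>u\<close>. The same holds on the set \<open>J\<close> where the smallest ratio is attained. Hence,
  for every \<open>t > 1\<close>, \<open>f\<close> (divided by the eigenvalue) preserves the set of vectors between \<open>u\<close> and
  \<open>t u\<close> that equal \<open>t u\<close> on \<open>I\<close> and \<open>u\<close> on \<open>J\<close>; a fixed point there is an eigenvector at distance
  at least \<open>ln t\<close> from \<open>u\<close>.
\<close>

section \<open>Real analytic functions along lines\<close>

lemma finite_multi_indices_of_degree:
  "finite {\<alpha> :: 'n::finite \<Rightarrow> nat. sum \<alpha> UNIV = k}"
proof (rule finite_subset)
  show "{\<alpha> :: 'n \<Rightarrow> nat. sum \<alpha> UNIV = k} \<subseteq> UNIV \<rightarrow>\<^sub>E {..k}"
    by (auto simp: PiE_def intro!: member_le_sum)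
  show "finite ((UNIV :: 'n set) \<rightarrow>\<^sub>E {..k})"
    by (intro finite_PiE) auto
qed

text \<open>With displacement \<open>h *\<^sub>R d\<close>, each multi-index term becomes a constant
  times \<open>h ^ deg \<alpha>\<close>. As \<open>has_sum\<close> is unconditional, the terms may
  be regrouped by total degree, each degree contributing finitely many, which leaves a power series
  in \<open>h\<close>.\<close>

lemma real_analytic_on_line:
  fixes g :: "real ^ 'n \<Rightarrow> real"
  assumes "real_analytic_on g S" and "p + s *\<^sub>R d \<in> S"
  obtains r a where "r > 0"
    and "\<And>h. \<bar>h\<bar> < r \<Longrightarrow> (\<lambda>k. a k * h ^ k) sums g (p + (s + h) *\<^sub>R d)"
proof -
  let ?x = "p + s *\<^sub>R d"
  obtain R c where R: "R > 0" and
    c: "\<And>y. y \<in> ball ?x R \<Longrightarrow>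
      ((\<lambda>\<alpha>::'n \<Rightarrow> nat. c \<alpha> * (\<Prod>i\<in>UNIV. (y $ i - ?x $ i) ^ \<alpha> i)) has_sum g y) UNIV"
    using assms unfolding real_analytic_on_def by meson
  define deg where "deg = (\<lambda>\<alpha> :: 'n \<Rightarrow> nat. sum \<alpha> UNIV)"
  define a where "a = (\<lambda>k. \<Sum>\<alpha> | deg \<alpha> = k. c \<alpha> * (\<Prod>i\<in>UNIV. (d $ i) ^ \<alpha> i))"
  \<comment> \<open>The \<open>+ 1\<close> keeps the denominator positive when
    \<open>d = 0\<close>.\<close>
  define r where "r = R / (norm d + 1)"
  have "r > 0"
    using R by (simp add: r_def add_nonneg_pos)
  moreover have "(\<lambda>k. a k * h ^ k) sums g (p + (s + h) *\<^sub>R d)" if h: "\<bar>h\<bar> < r" for h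
  proof -
    let ?y = "p + (s + h) *\<^sub>R d"
    let ?t = "\<lambda>\<alpha>. c \<alpha> * (\<Prod>i\<in>UNIV. (d $ i) ^ \<alpha> i) * h ^ deg \<alpha>"
    have "\<bar>h\<bar> * norm d \<le> \<bar>h\<bar> * (norm d + 1)"
      by (simp add: mult_left_mono)
    also have "\<dots> < R"
      using h by (simp add: r_def pos_less_divide_eq add_nonneg_pos)
    finally have "?y \<in> ball ?x R"
      by (simp add: dist_norm algebra_simps)
    moreover have "(\<Prod>i\<in>UNIV. (?y $ i - ?x $ i) ^ \<alpha> i) = (\<Prod>i\<in>UNIV. (d $ i) ^ \<alpha> i) * h ^ deg \<alpha>"
      for \<alpha> :: "'n \<Rightarrow> nat"
      by (simp add: algebra_simps power_mult_distrib prod.distrib power_sum deg_def)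
    ultimately have "(?t has_sum g ?y) UNIV"
      using c[of ?y] by (simp add: mult.assoc)
    also have "(?t has_sum g ?y) UNIV \<longleftrightarrow>
        ((\<lambda>(k, \<alpha>). ?t \<alpha>) has_sum g ?y) (Sigma UNIV (\<lambda>k. {\<alpha>. deg \<alpha> = k}))"
      by (rule has_sum_reindex_bij_witness[where i = snd and j = "\<lambda>\<alpha>. (deg \<alpha>, \<alpha>)"]) auto
    finally have "((\<lambda>k. a k * h ^ k) has_sum g ?y) UNIV"
    proof (rule has_sum_SigmaD)
      fix k
      have "a k * h ^ k = (\<Sum>\<alpha> | deg \<alpha> = k. ?t \<alpha>)"
        unfolding a_def sum_distrib_right by (rule sum.cong) auto
      then show "((\<lambda>\<alpha>. case (k, \<alpha>) of (k, \<alpha>) \<Rightarrow> ?t \<alpha>) has_sum a k * h ^ k) {\<alpha>. deg \<alpha> = k}"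
        using finite_multi_indices_of_degree[of k]
        by (auto simp: deg_def intro!: has_sum_finiteI)
    qed
    then show ?thesis
      by (rule has_sum_imp_sums)
  qed
  ultimately show thesis
    using that by blast
qed

text \<open>Isolation of zeros, for the series of \<open>\<phi> - c\<close> about \<open>s\<close>.
  Whether \<open>\<phi> s = c\<close> is left open, hence the punctured ball.\<close>

lemma power_series_const_or_isolated:
  fixes \<phi> :: "real \<Rightarrow> real"
  assumes "r > 0" and a: "\<And>h. \<bar>h\<bar> < r \<Longrightarrow> (\<lambda>k. a k * h ^ k) sums \<phi> (s + h)"
  shows "\<exists>e>0. (\<forall>x\<in>ball s e. \<phi> x = c) \<or> (\<forall>x\<in>ball s e - {s}. \<phi> x \<noteq> c)"
proof -
  define b where "b = a(0 := a 0 - c)"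
  have b: "(\<lambda>k. b k * (x - s) ^ k) sums (\<phi> x - c)" if "norm (x - s) < r" for x
  proof -
    have "(\<lambda>k. a k * (x - s) ^ k) sums \<phi> x"
      using a[of "x - s"] that by simp
    moreover have "(\<lambda>k. if k = 0 then c else 0) sums c"
      using sums_If_finite_set[of "{0}" "\<lambda>_. c"] by simp
    ultimately have "(\<lambda>k. a k * (x - s) ^ k - (if k = 0 then c else 0)) sums (\<phi> x - c)"
      by (rule sums_diff)
    then show ?thesis
      by (rule sums_cong[THEN iffD1, rotated]) (simp add: b_def)
  qed
  show ?thesis
  proof (cases "\<forall>k. b k = 0")
    case True
    then have "\<phi> x = c" if "x \<in> ball s r" for x
      using b[of x] that sums_unique2[OF _ sums_zero] by (fastforce simp: dist_real_def)
    then show ?thesis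
      using \<open>r > 0\<close> by blast
  next
    case False
    then obtain m where m: "b m \<noteq> 0" by blast
    \<comment> \<open>The extra factor \<open>x - s\<close> provides the zero at \<open>s\<close> that \<open>powser_0_nonzero\<close> requires.\<close>
    define b' where "b' = (\<lambda>k. case k of 0 \<Rightarrow> 0 | Suc k \<Rightarrow> b k)"
    have "(\<lambda>k. b' k * (x - s) ^ k) sums ((x - s) * (\<phi> x - c))" if "norm (x - s) < r" for x
    proof -
      have "(\<lambda>k. b' (Suc k) * (x - s) ^ Suc k) sums ((x - s) * (\<phi> x - c))"
        using sums_mult[OF b[OF that], of "x - s"] by (simp add: b'_def mult_ac)
      then show ?thesis
        by (subst (asm) sums_Suc_iff) (simp add: b'_def)
    qed
    then obtain e where "e > 0" "\<And>x. x \<in> cball s e - {s} \<Longrightarrow> (x - s) * (\<phi> x - c) \<noteq> 0"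
      using powser_0_nonzero[of r s b' "\<lambda>x. (x - s) * (\<phi> x - c)" "Suc m"] \<open>r > 0\<close> m
      by (auto simp: b'_def)
    then show ?thesis
      by (intro exI[of _ e]) auto
  qed
qed

text \<open>Identity theorem on a segment: being equal to \<open>c\<close> near a point is locally
  constant along the segment, so connectedness carries it from \<open>s = 0\<close> to
  \<open>s = 1\<close>.\<close>

lemma real_analytic_const_on_segment:
  fixes g :: "real ^ 'n \<Rightarrow> real"
  assumes g: "real_analytic_on g S"
    and seg: "\<And>s. s \<in> {0..1} \<Longrightarrow> p + s *\<^sub>R d \<in> S"
    and "\<forall>\<^sub>F s in nhds 0. g (p + s *\<^sub>R d) = c"
  shows "g (p + d) = c"
proof -
  let ?P = "\<lambda>s. \<forall>\<^sub>F x in nhds s. g (p + x *\<^sub>R d) = c"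
  have "?P (1::real)"
  proof (rule connected_induction_simple[of "{0..1::real}" 0 1 ?P])
    fix s :: real
    assume "s \<in> {0..1}"
    then obtain r a where "r > 0"
      and "\<And>h. \<bar>h\<bar> < r \<Longrightarrow> (\<lambda>k. a k * h ^ k) sums g (p + (s + h) *\<^sub>R d)"
      using real_analytic_on_line[OF g seg] by metis
    then obtain e where "e > 0" and
      e: "(\<forall>x\<in>ball s e. g (p + x *\<^sub>R d) = c) \<or> (\<forall>x\<in>ball s e - {s}. g (p + x *\<^sub>R d) \<noteq> c)"
      using power_series_const_or_isolated[of r a "\<lambda>x. g (p + x *\<^sub>R d)"] by blast
    \<comment> \<open>If the value is \<open>c\<close> near \<open>x\<close>, it is \<open>c\<close>
      at some point of the ball other than \<open>s\<close>, even when \<open>x = s\<close>. This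
      rules out the isolated alternative.\<close>
    have "?P y" if xy: "x \<in> ball s e" "y \<in> ball s e" and x: "?P x" for x y
    proof -
      have "\<forall>\<^sub>F z in at x. g (p + z *\<^sub>R d) = c"
        using x by (simp add: eventually_nhds_conv_at)
      moreover have "\<forall>\<^sub>F z in at x. z \<in> ball s e - {s}"
        using eventually_at_in_open'[OF open_ball xy(1)] eventually_neq_at_within[of s x UNIV]
        by eventually_elim simp
      ultimately have "\<forall>\<^sub>F z in at x. z \<in> ball s e - {s} \<and> g (p + z *\<^sub>R d) = c"
        by eventually_elim simp
      then have "\<exists>z. z \<in> ball s e - {s} \<and> g (p + z *\<^sub>R d) = c"
        by (rule eventually_happens'[OF trivial_limit_at])
      then have "\<forall>x\<in>ball s e. g (p + x *\<^sub>R d) = c"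
        using e by metis
      then show ?thesis
        using eventually_nhds_in_open[OF open_ball xy(2)] by (auto elim: eventually_mono)
    qed
    then have "\<forall>x\<in>{0..1} \<inter> ball s e. \<forall>y\<in>{0..1} \<inter> ball s e. ?P x \<longrightarrow> ?P y"
      by blast
    moreover have "openin (top_of_set {0..1}) ({0..1} \<inter> ball s e)"
      by (rule openin_open_Int) (rule open_ball)
    moreover have "s \<in> {0..1} \<inter> ball s e"
      using \<open>e > 0\<close> \<open>s \<in> {0..1}\<close> by simp
    ultimately show "\<exists>T. openin (top_of_set {0..1}) T \<and> s \<in> T \<and> (\<forall>x\<in>T. \<forall>y\<in>T. ?P x \<longrightarrow> ?P y)"
      by blast
  qed (use assms(3) in auto)
  then show ?thesis
    by (auto dest: eventually_nhds_x_imp_x)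
qed

section \<open>Monotone maps on the positive cone\<close>

lemma pos_cone_segment:
  assumes "x \<in> pos_cone" "y \<in> pos_cone" "s \<in> {0..1}"
  shows "x + s *\<^sub>R (y - x) \<in> pos_cone"
proof -
  have "0 < (1 - s) * x $ i + s * y $ i" for i
    using assms by (cases "s = 1")
      (auto simp: pos_cone_def less_imp_le intro!: add_pos_nonneg)
  then show ?thesis
    by (simp add: pos_cone_def algebra_simps)
qed

lemma pos_cone_scaleR: "x \<in> pos_cone \<Longrightarrow> t > 0 \<Longrightarrow> t *\<^sub>R x \<in> pos_cone"
  by (simp add: pos_cone_def)

text \<open>Monotonicity makes \<open>g\<close> constant on the order interval between \<open>x\<close> and \<open>y\<close>, which has nonempty
  interior relative to the slice through \<open>x\<close> that fixes the coordinates where \<open>x\<close> and \<open>y\<close> agree.\<close>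

lemma monotone_analytic_rigid:
  fixes g :: "real ^ 'n \<Rightarrow> real"
  assumes an: "real_analytic_on g pos_cone"
    and mono: "\<And>x y. x \<in> pos_cone \<Longrightarrow> y \<in> pos_cone \<Longrightarrow> vle x y \<Longrightarrow> g x \<le> g y"
    and x: "x \<in> pos_cone" and y: "y \<in> pos_cone" and "vle x y" and eq: "g x = g y"
    and w: "w \<in> pos_cone" and agree: "\<And>i. x $ i = y $ i \<Longrightarrow> w $ i = x $ i"
  shows "g w = g x"
proof -
  \<comment> \<open>The midpoint lies strictly between \<open>x\<close> and \<open>y\<close>
    wherever they differ, which leaves room to move a little towards \<open>w\<close>. In the other
    coordinates \<open>w\<close> equals \<open>m\<close>, so nothing moves.\<close>
  define m where "m = x + (1/2) *\<^sub>R (y - x)"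
  have m: "m \<in> pos_cone"
    unfolding m_def using x y by (intro pos_cone_segment) auto
  have inside: "\<forall>\<^sub>F s in nhds 0. x $ i \<le> (m + s *\<^sub>R (w - m)) $ i \<and> (m + s *\<^sub>R (w - m)) $ i \<le> y $ i"
    for i
  proof (cases "x $ i = y $ i")
    case True
    then show ?thesis
      using agree[of i] by (simp add: m_def)
  next
    case False
    then have "x $ i < m $ i" "m $ i < y $ i"
      using \<open>vle x y\<close> by (auto simp: vle_def m_def less_le field_simps)
    moreover have "((\<lambda>s. (m + s *\<^sub>R (w - m)) $ i) \<longlongrightarrow> (m + 0 *\<^sub>R (w - m)) $ i) (nhds 0)"
      by (intro tendsto_intros filterlim_ident)
    ultimately have "\<forall>\<^sub>F s in nhds 0. x $ i < (m + s *\<^sub>R (w - m)) $ i"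
      "\<forall>\<^sub>F s in nhds 0. (m + s *\<^sub>R (w - m)) $ i < y $ i"
      by (auto dest: order_tendstoD)
    then show ?thesis
      by eventually_elim auto
  qed
  have "\<forall>\<^sub>F s in nhds 0. \<forall>i.
      x $ i \<le> (m + s *\<^sub>R (w - m)) $ i \<and> (m + s *\<^sub>R (w - m)) $ i \<le> y $ i"
    using inside by (rule eventually_all_finite)
  then have "\<forall>\<^sub>F s in nhds 0. g (m + s *\<^sub>R (w - m)) = g x"
  proof eventually_elim
    case (elim s)
    let ?z = "m + s *\<^sub>R (w - m)"
    have le: "vle x ?z" "vle ?z y"
      using elim by (auto simp: vle_def)
    have "?z \<in> pos_cone"
      using x le(1) unfolding pos_cone_def vle_def mem_Collect_eq by (meson less_le_trans)
    then show ?case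
      using mono[OF x _ le(1)] mono[OF _ y le(2)] eq by simp
  qed
  from real_analytic_const_on_segment[OF an pos_cone_segment[OF m w] this] show ?thesis
    by simp
qed

text \<open>As in Knaster--Tarski, the supremum of the sub-eigenvectors in the interval is an eigenvector.\<close>

lemma order_preserving_eigenvector_between:
  fixes f :: "real ^ 'n \<Rightarrow> real ^ 'n"
  assumes op: "order_preserving_on pos_cone f" and "\<rho> > 0"
    and x: "x \<in> pos_cone" and "vle x y"
    and fx: "vle (\<rho> *\<^sub>R x) (f x)" and fy: "vle (f y) (\<rho> *\<^sub>R y)"
  obtains z where "vle x z" "vle z y" "f z = \<rho> *\<^sub>R z"
proof -
  have pos: "z \<in> pos_cone" if "vle x z" for z
    using x that unfolding pos_cone_def vle_def mem_Collect_eq by (meson less_le_trans)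
  have mono: "vle (f v) (f w)" if "vle x v" "vle v w" for v w
    using op that pos[of v] pos[of w] unfolding order_preserving_on_def vle_def
    by (meson order_trans)
  define P where "P = {z. vle x z \<and> vle z y \<and> vle (\<rho> *\<^sub>R z) (f z)}"
  define z where "z = (\<chi> i. SUP p\<in>P. p $ i)"
  have "x \<in> P"
    using \<open>vle x y\<close> fx by (simp add: P_def vle_def)
  have bdd: "bdd_above ((\<lambda>p. p $ i) ` P)" for i
    by (rule bdd_aboveI[of _ "y $ i"]) (auto simp: P_def vle_def)
  have upper: "vle p z" if "p \<in> P" for p
    using that bdd by (auto simp: vle_def z_def intro: cSUP_upper)
  have least: "vle z w" if "\<And>p. p \<in> P \<Longrightarrow> vle p w" for w
    using that \<open>x \<in> P\<close> by (auto simp: vle_def z_def intro!: cSUP_least)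
  have xz: "vle x z"
    using upper \<open>x \<in> P\<close> .
  have zy: "vle z y"
    by (rule least) (simp add: P_def)
  \<comment> \<open>\<open>f z / \<rho>\<close> bounds \<open>P\<close> from above, so it dominates
    the supremum \<open>z\<close>; it then turns out to be a member of \<open>P\<close>, so
    \<open>z\<close> dominates it.\<close>
  have "vle z ((1/\<rho>) *\<^sub>R f z)"
  proof (rule least)
    fix p assume p: "p \<in> P"
    then have "vle (\<rho> *\<^sub>R p) (f z)"
      using mono[OF _ upper[OF p]] by (auto simp: P_def vle_def intro: order_trans)
    then show "vle p ((1/\<rho>) *\<^sub>R f z)"
      using \<open>\<rho> > 0\<close> by (simp add: vle_def field_simps)
  qed
  moreover have "vle ((1/\<rho>) *\<^sub>R f z) z"
  proof (rule upper)
    have "vle ((1/\<rho>) *\<^sub>R f z) y"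
      using mono[OF xz zy] fy \<open>\<rho> > 0\<close>
      by (auto simp: vle_def field_simps intro: order_trans)
    moreover have "vle x ((1/\<rho>) *\<^sub>R f z)"
      using calculation xz \<open>vle z ((1/\<rho>) *\<^sub>R f z)\<close> by (auto simp: vle_def intro: order_trans)
    moreover have "vle (f z) (f ((1/\<rho>) *\<^sub>R f z))"
      using mono[OF xz] \<open>vle z ((1/\<rho>) *\<^sub>R f z)\<close> .
    ultimately show "(1/\<rho>) *\<^sub>R f z \<in> P"
      using \<open>\<rho> > 0\<close> by (simp add: P_def vle_def)
  qed
  ultimately have "f z = \<rho> *\<^sub>R z"
    using \<open>\<rho> > 0\<close> by (simp add: vle_def vec_eq_iff field_simps order_eq_iff)
  then show thesis
    using that xz zy by blast
qed

section \<open>Eigenvectors\<close>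

lemma eigenvalue_pos:
  assumes "\<forall>x\<in>pos_cone. f x \<in> pos_cone" "u \<in> pos_cone" "f u = \<rho> *\<^sub>R u"
  shows "\<rho> > 0"
proof -
  fix i
  have "0 < u $ i" "0 < (\<rho> *\<^sub>R u) $ i"
    using assms unfolding pos_cone_def by force+
  then show ?thesis
    by (simp add: zero_less_mult_iff)
qed

text \<open>\<open>M\<close> is the largest ratio \<open>v $ i / u $ i\<close>. With
  \<open>u\<close> and \<open>v\<close> exchanged, it is the reciprocal of the smallest
  ratio.\<close>

lemma obtain_tight_upper_multiple:
  fixes u v :: "real ^ 'n"
  assumes "u \<in> pos_cone" "v \<in> pos_cone"
  obtains M i where "M > 0" "vle v (M *\<^sub>R u)" "v $ i = M * u $ i"
proof -
  obtain i where i: "\<And>j. v $ j / u $ j \<le> v $ i / u $ i"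
    using arg_min_if_finite(2)[of UNIV "\<lambda>j. - (v $ j / u $ j)"] by (force simp: not_less)
  show thesis
  proof (rule that)
    show "v $ i / u $ i > 0" "v $ i = v $ i / u $ i * u $ i"
      using assms by (auto simp: pos_cone_def order_less_imp_not_eq2)
    show "vle v ((v $ i / u $ i) *\<^sub>R u)"
      using i assms by (simp add: vle_def pos_cone_def pos_divide_le_eq)
  qed
qed

text \<open>Compare \<open>f v\<close> with \<open>f (M *\<^sub>R u)\<close> in a coordinate where
  \<open>v\<close> touches \<open>M *\<^sub>R u\<close>. By symmetry, all eigenvectors in the cone
  share one eigenvalue.\<close>

lemma eigenvalue_le:
  fixes f :: "real ^ 'n \<Rightarrow> real ^ 'n"
  assumes op: "order_preserving_on pos_cone f" and hom: "homogeneous_on pos_cone f"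
    and u: "u \<in> pos_cone" "f u = \<rho> *\<^sub>R u" and v: "v \<in> pos_cone" "f v = \<mu> *\<^sub>R v"
  shows "\<mu> \<le> \<rho>"
proof -
  obtain M i where M: "M > 0" "vle v (M *\<^sub>R u)" "v $ i = M * u $ i"
    using obtain_tight_upper_multiple u(1) v(1) .
  have "vle (f v) (f (M *\<^sub>R u))"
    using op u v M pos_cone_scaleR unfolding order_preserving_on_def by blast
  moreover have "f (M *\<^sub>R u) = M *\<^sub>R \<rho> *\<^sub>R u"
    using hom u M unfolding homogeneous_on_def by metis
  ultimately have "\<mu> * v $ i \<le> M * (\<rho> * u $ i)"
    using v by (simp add: vle_def mult.assoc)
  also have "\<dots> = \<rho> * v $ i"
    using M(3) by simp
  finally have "\<mu> * v $ i \<le> \<rho> * v $ i" .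
  then show ?thesis
    using v by (simp add: pos_cone_def)
qed

lemma ln_ratio_le_hilbert_metric:
  fixes x y :: "real ^ 'n"
  assumes "x \<in> pos_cone" "y \<in> pos_cone"
  shows "ln ((y $ i * x $ j) / (x $ i * y $ j)) \<le> hilbert_metric x y"
proof -
  let ?q = "\<lambda>i j. (y $ i * x $ j) / (x $ i * y $ j)"
  have "{?q i j | i j. True} = (\<lambda>(i, j). ?q i j) ` UNIV"
    by auto
  then have "?q i j \<le> Max {?q i j | i j. True}"
    by (intro Max_ge) auto
  moreover have "0 < ?q i j"
    using assms by (simp add: pos_cone_def)
  ultimately show ?thesis
    unfolding hilbert_metric_def by simp
qed

lemma hilbert_metric_scaleR:
  fixes u :: "real ^ 'n"
  assumes "u \<in> pos_cone" "s > 0" "t > 0"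
  shows "hilbert_metric (s *\<^sub>R u) (t *\<^sub>R u) = 0"
proof -
  have "u $ i \<noteq> 0" for i
    using assms(1) by (auto simp: pos_cone_def order_less_imp_not_eq2)
  then have "{((t *\<^sub>R u) $ i * (s *\<^sub>R u) $ j) / ((s *\<^sub>R u) $ i * (t *\<^sub>R u) $ j) | i j. True} = {1}"
    using assms by auto
  then show ?thesis
    by (simp add: hilbert_metric_def)
qed

text \<open>As \<open>t\<close> is arbitrary, non-proportional eigenvectors make the eigenspace
  unbounded.\<close>

lemma far_eigenvector:
  fixes f :: "real ^ 'n \<Rightarrow> real ^ 'n"
  assumes maps: "\<forall>x\<in>pos_cone. f x \<in> pos_cone"
    and op: "order_preserving_on pos_cone f"
    and hom: "homogeneous_on pos_cone f"
    and an: "\<forall>i. real_analytic_on (\<lambda>x. f x $ i) pos_cone"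
    and u: "u \<in> eigenspace_pos f" and v: "v \<in> eigenspace_pos f"
    and nonprop: "\<not> (\<exists>t>0. v = t *\<^sub>R u)"
    and "t > 1"
  shows "\<exists>z\<in>eigenspace_pos f. ln t \<le> hilbert_metric u z"
proof -
  obtain \<rho> \<mu> where uc: "u \<in> pos_cone" "f u = \<rho> *\<^sub>R u" and vc: "v \<in> pos_cone" "f v = \<mu> *\<^sub>R v"
    using u v by (auto simp: eigenspace_pos_def)
  have "\<mu> = \<rho>"
    using eigenvalue_le[OF op hom] uc vc by (meson order_antisym)
  have "\<rho> > 0"
    using eigenvalue_pos maps uc by blast
  have fscale: "f (s *\<^sub>R u) = \<rho> *\<^sub>R s *\<^sub>R u" if "s > 0" for s
    using hom uc that by (simp add: homogeneous_on_def mult.commute)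
  have mono: "f x $ i \<le> f y $ i" if "x \<in> pos_cone" "y \<in> pos_cone" "vle x y" for x y i
    using op that by (auto simp: order_preserving_on_def vle_def)
  obtain M i where M: "M > 0" "vle v (M *\<^sub>R u)" "v $ i = M * u $ i"
    using obtain_tight_upper_multiple uc(1) vc(1) .
  obtain m' j where m': "m' > 0" "vle u (m' *\<^sub>R v)" "u $ j = m' * v $ j"
    using obtain_tight_upper_multiple vc(1) uc(1) .
  define m where "m = 1 / m'"
  have m: "m > 0" "vle (m *\<^sub>R u) v" "v $ j = m * u $ j"
    using m' by (auto simp: m_def vle_def field_simps)
  have u0: "u $ k > 0" for k
    using uc by (simp add: pos_cone_def)
  have "m \<noteq> M"
  proof
    assume "m = M"
    then have "v = M *\<^sub>R u"
      using M m by (auto simp: vle_def vec_eq_iff intro: order_antisym)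
    then show False
      using nonprop M by blast
  qed
  define I where "I = {k. v $ k = M * u $ k}"
  define J where "J = {k. v $ k = m * u $ k}"
  have disj: "I \<inter> J = {}"
    using \<open>m \<noteq> M\<close> u0 by (auto simp: I_def J_def order_less_imp_not_eq2)
  \<comment> \<open>On \<open>I\<close>, both \<open>v\<close> and \<open>M *\<^sub>R u\<close> and
    their images agree. The factor \<open>M / s\<close> makes \<open>w\<close> agree with
    \<open>v\<close> on \<open>I\<close>, so rigidity applies; homogeneity then removes the
    factor.\<close>
  have upper: "f w $ k = \<rho> * w $ k"
    if w: "w \<in> pos_cone" "\<And>k. k \<in> I \<Longrightarrow> w $ k = s * u $ k" and "s > 0" "k \<in> I" for w s k
  proof -
    let ?w = "(M / s) *\<^sub>R w"
    have "f ?w $ k = f v $ k"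
    proof (rule monotone_analytic_rigid[of "\<lambda>x. f x $ k"])
      show "f v $ k = f (M *\<^sub>R u) $ k"
        using \<open>k \<in> I\<close> vc M fscale \<open>\<mu> = \<rho>\<close> by (simp add: I_def)
      show "?w \<in> pos_cone"
        using w M \<open>s > 0\<close> by (intro pos_cone_scaleR) auto
      show "?w $ i = v $ i" if "v $ i = (M *\<^sub>R u) $ i" for i
        using that w(2)[of i] \<open>s > 0\<close> by (simp add: I_def)
    qed (use an mono vc uc M pos_cone_scaleR in auto)
    moreover have "f ?w = (M / s) *\<^sub>R f w"
      using hom w M \<open>s > 0\<close> by (simp add: homogeneous_on_def)
    ultimately show ?thesis
      using vc \<open>\<mu> = \<rho>\<close> \<open>k \<in> I\<close> w(2) M \<open>s > 0\<close> by (simp add: I_def field_simps)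
  qed
  \<comment> \<open>The same argument on \<open>J\<close>, between \<open>m *\<^sub>R u\<close> and
    \<open>v\<close>.\<close>
  have lower: "f w $ k = \<rho> * w $ k"
    if w: "w \<in> pos_cone" "\<And>k. k \<in> J \<Longrightarrow> w $ k = u $ k" and "k \<in> J" for w k
  proof -
    let ?w = "m *\<^sub>R w"
    have "f ?w $ k = f (m *\<^sub>R u) $ k"
    proof (rule monotone_analytic_rigid[of "\<lambda>x. f x $ k"])
      show "f (m *\<^sub>R u) $ k = f v $ k"
        using \<open>k \<in> J\<close> vc m fscale \<open>\<mu> = \<rho>\<close> by (simp add: J_def)
      show "?w \<in> pos_cone"
        using w m by (intro pos_cone_scaleR) auto
      show "?w $ i = (m *\<^sub>R u) $ i" if "(m *\<^sub>R u) $ i = v $ i" for i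
        using that w(2)[of i] by (simp add: J_def)
    qed (use an mono vc uc m pos_cone_scaleR in auto)
    moreover have "f ?w = m *\<^sub>R f w"
      using hom w m by (simp add: homogeneous_on_def)
    ultimately show ?thesis
      using fscale \<open>k \<in> J\<close> w(2) m by simp
  qed
  \<comment> \<open>\<open>x\<close> and \<open>y\<close> are the least and the greatest vector
    between \<open>u\<close> and \<open>t *\<^sub>R u\<close> with the prescribed values on
    \<open>I\<close> and \<open>J\<close>.\<close>
  define x where "x = (\<chi> k. if k \<in> I then t * u $ k else u $ k)"
  define y where "y = (\<chi> k. if k \<in> J then u $ k else t * u $ k)"
  have "t > 0"
    using \<open>t > 1\<close> by simp
  have le_t: "u $ k \<le> t * u $ k" for k
    using u0[of k] \<open>t > 1\<close> by simp
  have "x \<in> pos_cone" "y \<in> pos_cone"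
    using u0 \<open>t > 0\<close> by (auto simp: x_def y_def pos_cone_def)
  have "vle x y"
    using disj le_t by (auto simp: vle_def x_def y_def)
  \<comment> \<open>On \<open>I\<close> equality holds by \<open>upper\<close>; elsewhere
    \<open>x\<close> equals \<open>u\<close>, and monotonicity from \<open>u\<close> to
    \<open>x\<close> suffices. The bound for \<open>y\<close> is dual, with \<open>lower\<close> and
    \<open>t *\<^sub>R u\<close>.\<close>
  have "vle (\<rho> *\<^sub>R x) (f x)"
    unfolding vle_def
  proof
    fix k
    show "(\<rho> *\<^sub>R x) $ k \<le> f x $ k"
    proof (cases "k \<in> I")
      case True
      then show ?thesis
        using upper[of x t k] \<open>x \<in> pos_cone\<close> \<open>t > 0\<close> by (simp add: x_def)
    next
      case False
      have "vle u x"
        using le_t by (simp add: vle_def x_def)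
      then show ?thesis
        using mono[OF uc(1) \<open>x \<in> pos_cone\<close>, of k] uc(2) False by (simp add: x_def)
    qed
  qed
  moreover have "vle (f y) (\<rho> *\<^sub>R y)"
    unfolding vle_def
  proof
    fix k
    show "f y $ k \<le> (\<rho> *\<^sub>R y) $ k"
    proof (cases "k \<in> J")
      case True
      then show ?thesis
        using lower[of y k] \<open>y \<in> pos_cone\<close> by (simp add: y_def)
    next
      case False
      have "vle y (t *\<^sub>R u)"
        using le_t by (simp add: vle_def y_def)
      then show ?thesis
        using mono[OF \<open>y \<in> pos_cone\<close> pos_cone_scaleR[OF uc(1) \<open>t > 0\<close>], of k]
          fscale[OF \<open>t > 0\<close>] False by (simp add: y_def)
    qed
  qed
  ultimately obtain z where z: "vle x z" "vle z y" "f z = \<rho> *\<^sub>R z"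
    using order_preserving_eigenvector_between[OF op \<open>\<rho> > 0\<close> \<open>x \<in> pos_cone\<close> \<open>vle x y\<close>] by blast
  have zc: "z \<in> pos_cone"
    using \<open>x \<in> pos_cone\<close> z(1) unfolding pos_cone_def vle_def mem_Collect_eq
    by (meson less_le_trans)
  have "i \<in> I" "j \<in> J"
    using M m by (auto simp: I_def J_def)
  then have "i \<notin> J" "j \<notin> I"
    using disj by auto
  \<comment> \<open>\<open>x\<close> and \<open>y\<close> coincide at \<open>i\<close> and
    \<open>j\<close>, which pins \<open>z\<close> there; the cross ratio at \<open>i\<close>,
    \<open>j\<close> is then exactly \<open>t\<close>.\<close>
  then have "z $ i = t * u $ i" "z $ j = u $ j"
    using z(1)[unfolded vle_def, rule_format, of i] z(2)[unfolded vle_def, rule_format, of i]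
      z(1)[unfolded vle_def, rule_format, of j] z(2)[unfolded vle_def, rule_format, of j]
      \<open>i \<in> I\<close> \<open>j \<in> J\<close> by (auto simp: x_def y_def)
  then have "ln t \<le> hilbert_metric u z"
    using ln_ratio_le_hilbert_metric[OF uc(1) zc, of i j] u0[of i] u0[of j] by simp
  then show ?thesis
    using z(3) zc by (auto simp: eigenspace_pos_def)
qed

theorem theorem5p1:
  fixes f :: "real ^ 'n \<Rightarrow> real ^ 'n"
  assumes maps: "\<forall>x\<in>pos_cone. f x \<in> pos_cone"
    and op: "order_preserving_on pos_cone f"
    and hom: "homogeneous_on pos_cone f"
    and an: "\<forall>i. real_analytic_on (\<lambda>x. f x $ i) pos_cone"
  shows "(eigenspace_pos f \<noteq> {} \<and> hilbert_bounded (eigenspace_pos f)) \<longleftrightarrow>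
         (\<exists>u\<in>eigenspace_pos f. \<forall>v\<in>eigenspace_pos f. \<exists>t>0. v = t *\<^sub>R u)"
proof
  assume *: "eigenspace_pos f \<noteq> {} \<and> hilbert_bounded (eigenspace_pos f)"
  then obtain u where u: "u \<in> eigenspace_pos f"
    by blast
  obtain B where B: "\<And>x y. x \<in> eigenspace_pos f \<Longrightarrow> y \<in> eigenspace_pos f \<Longrightarrow> hilbert_metric x y \<le> B"
    using * by (auto simp: hilbert_bounded_def)
  have "\<exists>t>0. v = t *\<^sub>R u" if v: "v \<in> eigenspace_pos f" for v
  proof (rule ccontr)
    assume nonprop: "\<not> ?thesis"
    \<comment> \<open>The absolute value secures \<open>t > 1\<close> whatever the sign of
      \<open>B\<close>, and \<open>+ 1\<close> makes \<open>ln t\<close> exceed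
      \<open>B\<close>.\<close>
    have "1 < exp (\<bar>B\<bar> + 1)"
      by (simp add: add_nonneg_pos)
    from far_eigenvector[OF assms u v nonprop this]
    obtain z where "z \<in> eigenspace_pos f" "\<bar>B\<bar> + 1 \<le> hilbert_metric u z"
      by (auto simp only: ln_exp)
    then show False
      using B[OF u, of z] by linarith
  qed
  then show "\<exists>u\<in>eigenspace_pos f. \<forall>v\<in>eigenspace_pos f. \<exists>t>0. v = t *\<^sub>R u"
    using u by blast
next
  assume "\<exists>u\<in>eigenspace_pos f. \<forall>v\<in>eigenspace_pos f. \<exists>t>0. v = t *\<^sub>R u"
  then obtain u where u: "u \<in> eigenspace_pos f"
    and scaled: "\<And>v. v \<in> eigenspace_pos f \<Longrightarrow> \<exists>t>0. v = t *\<^sub>R u"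
    by blast
  have "hilbert_metric x y \<le> 0" if xy: "x \<in> eigenspace_pos f" "y \<in> eigenspace_pos f" for x y
  proof -
    obtain s t where "s > 0" "x = s *\<^sub>R u" "t > 0" "y = t *\<^sub>R u"
      using scaled xy by blast
    then show ?thesis
      using u by (simp add: eigenspace_pos_def hilbert_metric_scaleR)
  qed
  then have "hilbert_bounded (eigenspace_pos f)"
    unfolding hilbert_bounded_def by blast
  then show "eigenspace_pos f \<noteq> {} \<and> hilbert_bounded (eigenspace_pos f)"
    using u by blast
qed

end
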